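(* Let $V$ be a digraph on $\mathcal N=\{1,\dots,N\}$ with real arc weights, let $2\le k\le N-1$ with $\mathcal F^{k}(V)\neq\emptyset$, and suppose $\varphi_{k-1}-\varphi_k>\varphi_k-\varphi_{k+1}$ (this being considered satisfied when $\varphi_{k-1}=+\infty$). Then for every elementary set $\mathcal E$ of $\aleph_k$ and every forest $F\in\tilde{\mathcal F}^k(V)$, the induced subgraph $F|_{\mathcal E}$ is a tree.
   Context: $V$ is a directed graph with vertex set $\mathcal N$, arc set $\mathcal A V\subseteq\mathcal N^2$, and real weights $v_{ij}$ on arcs $(i,j)$. A forest is a digraph without directed circuits (loops count as circuits) in which every vertex has outdegree $0$ or $1$; its trees are its weakly connected components; the root of a tree is its unique vertex of outdegree $0$; a digraph is a tree if it is a forest with exactly one weakly connected component. $\mathcal F^k(V)$ is the set of spanning subgraphs of $V$ that are forests with exactly $k$ trees; $\Sigma^F=\sum_{(i,j)\in\mathcal A F}v_{ij}$; $\varphi_k=\min_{F\in\mathcal F^k(V)}\Sigma^F$ ($+\infty$ if empty); $\tilde{\mathcal F}^k(V)=\{F\in\mathcal F^k(V):\Sigma^F=\varphi_k\}$. $\aleph_k$ is the algebra of subsets of $\mathcal N$ generated by the vertex sets of all trees of all forests in $\tilde{\mathcal F}^k(V)$; its elementary sets are its minimal nonempty members. $F|_{\mathcal S}$ is the subgraph of $F$ induced by $\mathcal S$ (vertex set $\mathcal S$, arcs of $F$ with both endpoints in $\mathcal S$). *)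

theory Defs
  imports
    "Graph_Theory.Digraph_Component"
    "HOL-Analysis.Sigma_Algebra"
begin

text \<open>
  The library predicate \<^const>\<open>Digraph_Component.forest\<close> only excludes directed cycles
  (with loops counting as cycles). Here forests are moreover finite, and each vertex is the tail of
  at most one arc, so that arcs point towards the roots.
\<close>

definition in_forest :: "('a, 'b) pre_digraph \<Rightarrow> bool" where
  "in_forest G \<longleftrightarrow>
     fin_digraph G \<and> Digraph_Component.forest G \<and> (\<forall>u \<in> verts G. out_degree G u \<le> 1)"

text \<open>\<^const>\<open>Digraph_Component.connected\<close> is weak connectedness and requires a nonempty vertex set.\<close>

definition weak_components :: "('a, 'b) pre_digraph \<Rightarrow> ('a, 'b) pre_digraph set" where
  "weak_components G = {H. pre_digraph.max_subgraph G Digraph_Component.connected H}"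

definition in_tree :: "('a, 'b) pre_digraph \<Rightarrow> bool" where
  "in_tree G \<longleftrightarrow> in_forest G \<and> card (weak_components G) = 1"

definition spanning_forests :: "('a, 'b) pre_digraph \<Rightarrow> nat \<Rightarrow> ('a, 'b) pre_digraph set" where
  "spanning_forests V k =
     {F. Digraph_Component.spanning F V \<and> in_forest F \<and> card (weak_components F) = k}"

definition arc_weight :: "('b \<Rightarrow> real) \<Rightarrow> ('a, 'b) pre_digraph \<Rightarrow> real" where
  "arc_weight v F = (\<Sum>e \<in> arcs F. v e)"

text \<open>
  A finite digraph has finitely many spanning forests, so the infimum is a minimum unless there are
  none, in which case it is \<open>\<infinity>\<close>.
\<close>

definition min_forest_weight :: "('a, 'b) pre_digraph \<Rightarrow> ('b \<Rightarrow> real) \<Rightarrow> nat \<Rightarrow> ereal" where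
  "min_forest_weight V v k = (INF F \<in> spanning_forests V k. ereal (arc_weight v F))"

definition min_forests ::
    "('a, 'b) pre_digraph \<Rightarrow> ('b \<Rightarrow> real) \<Rightarrow> nat \<Rightarrow> ('a, 'b) pre_digraph set" where
  "min_forests V v k =
     {F \<in> spanning_forests V k. ereal (arc_weight v F) = min_forest_weight V v k}"

definition generated_algebra :: "'a set \<Rightarrow> 'a set set \<Rightarrow> 'a set set" where
  "generated_algebra \<Omega> \<G> = \<Inter> {M. algebra \<Omega> M \<and> \<G> \<subseteq> M}"

definition forest_algebra ::
    "('a, 'b) pre_digraph \<Rightarrow> ('b \<Rightarrow> real) \<Rightarrow> nat \<Rightarrow> 'a set set" where
  "forest_algebra V v k =
     generated_algebra (verts V) (\<Union>F \<in> min_forests V v k. verts ` weak_components F)"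

definition elementary_sets :: "'a set set \<Rightarrow> 'a set set" where
  "elementary_sets M = {E \<in> M. E \<noteq> {} \<and> (\<forall>B \<in> M. B \<noteq> {} \<and> B \<subseteq> E \<longrightarrow> B = E)}"

end

(*
A spanning forest is a map f sending each vertex to its successor and each root to itself. For two
minimal k-forests f, g and a vertex set A, exchange the arcs leaving A. If both results are forests,
their weights add up to twice the minimum. So both are minimal if they have k roots each, and by the
strict inequality they cannot have k-1 and k+1 roots. Taking for A a tree of g shows that every tree
of g contains a root of f, hence exactly one.

The key claim is: if e1, e2 share a tree in every minimal forest and D is their tree in g, then their
h-paths cannot leave D at different vertices u1, u2. We may assume that h = g outside D. Let B be the set
of vertices whose h-path passes u1, let b be the first vertex outside B on the g-path of e1, and exchange
g and h on the vertices of B whose g-path passes b. If the g-path of e2 avoids this set, the new forest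
still has e1 and e2 in the tree of the old root and differs from h at fewer vertices. So, by minimality,
the g-path of e2 meets B before reaching b; by symmetry this gives a circuit in g.

Now let x, y be vertices of an elementary set E without f-arc into E, where the f-path of y avoids x
(so x is no root, since y lies in its tree). Some minimal g separates f x from E. With D the tree of g
containing E, following f inside D and g outside is minimal, and x, y leave D at different vertices.
*)
theory Submission
  imports Defs
begin

section \<open>Forests as parent maps\<close>

text \<open>\<open>reach_in A f x y\<close>: all vertices of the \<open>f\<close>-path from \<open>x\<close> to \<open>y\<close> lie in \<open>A\<close>,
  except possibly \<open>y\<close> itself.\<close>

inductive reach_in :: "'a set \<Rightarrow> ('a \<Rightarrow> 'a) \<Rightarrow> 'a \<Rightarrow> 'a \<Rightarrow> bool"
  for A :: "'a set" and f :: "'a \<Rightarrow> 'a" and x :: 'a where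
  refl [intro!, simp]: "reach_in A f x x"
| step: "reach_in A f x y \<Longrightarrow> y \<in> A \<Longrightarrow> reach_in A f x (f y)"

abbreviation reach :: "('a \<Rightarrow> 'a) \<Rightarrow> 'a \<Rightarrow> 'a \<Rightarrow> bool" where
  "reach f \<equiv> reach_in UNIV f"

definition mix :: "('a \<Rightarrow> 'a) \<Rightarrow> ('a \<Rightarrow> 'a) \<Rightarrow> 'a set \<Rightarrow> 'a \<Rightarrow> 'a" where
  "mix f g A x = (if x \<in> A then f x else g x)"

definition fixes_of :: "('a \<Rightarrow> 'a) \<Rightarrow> 'a set" where
  "fixes_of f = {x. f x = x}"

text \<open>A root, and every point outside the vertex set, is a fixed point, so that \<open>f\<close> is total.\<close>

definition forest_fun :: "'a set \<Rightarrow> ('a \<Rightarrow> 'a) \<Rightarrow> bool" where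
  "forest_fun N f \<longleftrightarrow> (\<forall>x. x \<notin> N \<longrightarrow> f x = x) \<and> (\<forall>x \<in> N. f x \<in> N) \<and> (\<forall>x. \<exists>r. reach f x r \<and> f r = r)"

definition root_of :: "('a \<Rightarrow> 'a) \<Rightarrow> 'a \<Rightarrow> 'a" where
  "root_of f x = (THE r. reach f x r \<and> f r = r)"

section \<open>Paths of a parent map, their first exits from a set, and roots\<close>

lemma reach_in_trans:
  assumes "reach_in A f x y" "reach_in A f y z"
  shows "reach_in A f x z"
  using assms(2,1) by (induction rule: reach_in.induct) (auto intro: reach_in.step)

lemma reach_in_step_left: "x \<in> A \<Longrightarrow> reach_in A f (f x) y \<Longrightarrow> reach_in A f x y"
  by (rule reach_in_trans[OF reach_in.step[OF reach_in.refl]])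

lemma reach_in_mono: "reach_in A f x y \<Longrightarrow> A \<subseteq> B \<Longrightarrow> reach_in B f x y"
  by (induction rule: reach_in.induct) (auto intro: reach_in.step)

lemma reach_in_imp_reach: "reach_in A f x y \<Longrightarrow> reach f x y"
  by (rule reach_in_mono) auto

lemma reach_step: "reach f x (f x)"
  by (rule reach_in.step) auto

lemma reach_step_left: "reach f (f x) y \<Longrightarrow> reach f x y"
  by (rule reach_in_step_left) auto

lemma reach_step_right: "reach f x y \<Longrightarrow> reach f x (f y)"
  by (rule reach_in.step) auto

lemma reach_cases: "reach f x y \<Longrightarrow> x = y \<or> reach f (f x) y"
  by (induction rule: reach_in.induct) (auto intro: reach_in.step)

lemma reach_fixed: "reach f x y \<Longrightarrow> f x = x \<Longrightarrow> y = x"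
  by (induction rule: reach_in.induct) auto

lemma reach_invariant: "reach f x y \<Longrightarrow> x \<in> S \<Longrightarrow> (\<And>z. z \<in> S \<Longrightarrow> f z \<in> S) \<Longrightarrow> y \<in> S"
  by (induction rule: reach_in.induct) auto

lemma reach_linear: "reach f x y \<Longrightarrow> reach f x z \<Longrightarrow> reach f y z \<or> reach f z y"
proof (induction rule: reach_in.induct)
  case (step y)
  then show ?case using reach_cases reach_step_right by metis
qed auto

lemma reach_in_cong: "reach_in A f x y \<Longrightarrow> (\<And>z. z \<in> A \<Longrightarrow> g z = f z) \<Longrightarrow> reach_in A g x y"
  by (induction rule: reach_in.induct) (auto intro: reach_in.refl, metis reach_in.step)

lemma reach_in_mix: "reach_in A f x y \<Longrightarrow> reach (mix f g A) x y"
  by (rule reach_in_imp_reach[of A]) (erule reach_in_cong, simp add: mix_def)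

lemma reach_in_mix_compl: "reach_in (- A) g x y \<Longrightarrow> reach (mix f g A) x y"
  by (rule reach_in_imp_reach[of "- A"]) (erule reach_in_cong, simp add: mix_def)

lemma reach_first_exit:
  "reach f x y \<Longrightarrow> reach_in S f x y \<or> (\<exists>b. b \<notin> S \<and> reach_in S f x b \<and> reach f b y)"
proof (induction rule: reach_in.induct)
  case (step y)
  then show ?case by (metis reach_in.step reach_in.refl UNIV_I)
qed auto

lemma reach_exit:
  assumes "reach f x y" "y \<notin> S"
  obtains b where "b \<notin> S" "reach_in S f x b" "reach f b y"
  using reach_first_exit[OF assms(1), of S] assms(2) by blast

lemma reach_in_last:
  assumes "reach_in S f x b" "x \<noteq> b"
  obtains a where "a \<in> S" "b = f a" "reach_in S f x a"
  using assms by (cases rule: reach_in.cases) auto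

lemma forest_funD:
  assumes "forest_fun N f"
  shows "x \<notin> N \<Longrightarrow> f x = x" "x \<in> N \<Longrightarrow> f x \<in> N" "\<exists>r. reach f x r \<and> f r = r"
  using assms by (auto simp: forest_fun_def)

lemma forest_root_unique:
  assumes "reach f x r" "f r = r" "reach f x s" "f s = s"
  shows "r = s"
  using assms reach_linear[of f x r s] reach_fixed by metis

lemma root_ofI: "reach f x r \<Longrightarrow> f r = r \<Longrightarrow> root_of f x = r"
  unfolding root_of_def using forest_root_unique by (metis (mono_tags, lifting) the_equality)

lemma root_of:
  assumes "forest_fun N f"
  shows "reach f x (root_of f x)" "f (root_of f x) = root_of f x"
  using forest_funD(3)[OF assms, of x] root_ofI by metis+

lemma root_of_reach:
  assumes "forest_fun N f" "reach f x y"
  shows "root_of f x = root_of f y"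
  using assms root_ofI root_of by (metis reach_in_trans)

text \<open>On a circuit through \<open>x\<close>, everything reachable from \<open>x\<close>
  reaches back to \<open>x\<close>. This includes a fixed point, which reaches only itself.\<close>

lemma forest_reach_antisym:
  assumes "forest_fun N f" "reach f x y" "reach f y x"
  shows "x = y"
proof (rule ccontr)
  assume ne: "x \<noteq> y"
  obtain r where r: "reach f x r" "f r = r" using forest_funD(3)[OF assms(1)] by blast
  have "reach f z x" if "reach f x z" for z
    using that
  proof (induction rule: reach_in.induct)
    case refl
    then show ?case by simp
  next
    case (step z)
    then have "z = x \<or> reach f (f z) x" using reach_cases by metis
    moreover have "reach f (f x) x"
      using reach_cases[OF assms(2)] ne assms(3) by (meson reach_in_trans)
    ultimately show ?case using step by auto
  qed
  then have "x = r" using r reach_fixed by metis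
  then show False using r assms(2) ne reach_fixed by metis
qed

lemma reach_in_N:
  assumes "forest_fun N f" "reach f x y"
  shows "x \<in> N \<longleftrightarrow> y \<in> N"
  using assms(2) by (induction rule: reach_in.induct) (use forest_funD[OF assms(1)] in metis)+

text \<open>A path of the mixed map follows \<open>g\<close> until it enters \<open>A\<close>, then
  \<open>f\<close> until it leaves \<open>A\<close>, then \<open>g\<close> again. By
  \<open>noret\<close> it never re-enters \<open>A\<close>, so it ends at a fixed point.\<close>

lemma mix_forest:
  assumes f: "forest_fun N f" and g: "forest_fun N g"
    and noret: "\<And>a z. a \<in> A \<Longrightarrow> f a \<notin> A \<Longrightarrow> reach g (f a) z \<Longrightarrow> z \<notin> A"
  shows "forest_fun N (mix f g A)"
proof -
  let ?m = "mix f g A"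
  have outside: "\<exists>r. reach ?m x r \<and> ?m r = r" if "\<And>z. reach g x z \<Longrightarrow> z \<notin> A" for x
  proof -
    obtain r where r: "reach g x r" "g r = r" using forest_funD(3)[OF g] by blast
    have "reach_in (- A) g x r"
    proof -
      consider "reach_in (- A) g x r" | b where "b \<in> A" "reach_in (- A) g x b"
        using reach_first_exit[OF r(1), of "- A"] by auto
      then show ?thesis
      proof cases
        case 2
        then show ?thesis using that reach_in_imp_reach by metis
      qed
    qed
    then show ?thesis using reach_in_mix_compl r that by (metis mix_def)
  qed
  have inside: "\<exists>r. reach ?m x r \<and> ?m r = r" if "x \<in> A" for x
  proof -
    obtain r where r: "reach f x r" "f r = r" using forest_funD(3)[OF f] by blast
    have exit: ?thesis if b: "b \<notin> A" "reach_in A f x b" for b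
    proof -
      obtain a where a: "a \<in> A" "b = f a" using reach_in_last[OF b(2)] b \<open>x \<in> A\<close> by metis
      then obtain r' where "reach ?m b r' \<and> ?m r' = r'" using outside noret b(1) by metis
      then show ?thesis using reach_in_mix[OF b(2)] by (meson reach_in_trans)
    qed
    show ?thesis
    proof (cases "reach_in A f x r \<and> r \<in> A")
      case True
      then show ?thesis using reach_in_mix r(2) by (metis mix_def)
    next
      \<comment> \<open>If \<open>r\<close> is reached through \<open>A\<close> but lies outside
        \<open>A\<close>, then \<open>r\<close> is itself the exit vertex.\<close>
      case False
      then show ?thesis using reach_first_exit[OF r(1), of A] exit by blast
    qed
  qed
  have "\<exists>r. reach ?m x r \<and> ?m r = r" for x
  proof -
    obtain r where r: "reach g x r" "g r = r" using forest_funD(3)[OF g] by blast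
    consider "r \<notin> A" "reach_in (- A) g x r" | b where "b \<in> A" "reach_in (- A) g x b"
      using reach_first_exit[OF r(1), of "- A"] by auto
    then show ?thesis
    proof cases
      case 1
      then show ?thesis using reach_in_mix_compl r by (metis mix_def)
    next
      case 2
      then show ?thesis using inside reach_in_mix_compl by (meson reach_in_trans)
    qed
  qed
  then show ?thesis using f g by (auto simp: forest_fun_def mix_def)
qed

text \<open>An \<open>f\<close>-arc leaving \<open>Y\<close> either starts at \<open>u\<close> or
  ends at a vertex that still reaches \<open>u\<close> under \<open>f\<close>. Its end therefore
  does not reach \<open>b\<close> under \<open>g\<close>, nor does anything on its
  \<open>g\<close>-path. For \<open>g\<close>-arcs the roles of \<open>u\<close> and
  \<open>b\<close> are swapped, and the last hypothesis handles an arc starting at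
  \<open>b\<close>.\<close>

lemma mix_forest_swap:
  assumes f: "forest_fun N f" and g: "forest_fun N g"
    and fu: "\<not> reach g (f u) b" and b: "g b = b \<or> \<not> reach f b u"
  defines "Y \<equiv> {x. reach f x u \<and> reach g x b}"
  shows "forest_fun N (mix f g Y)" "forest_fun N (mix g f Y)"
proof -
  show "forest_fun N (mix f g Y)"
  proof (rule mix_forest[OF f g])
    fix a z assume "a \<in> Y" "f a \<notin> Y" "reach g (f a) z"
    then have "\<not> reach g (f a) b" using fu reach_cases[of f a u] unfolding Y_def by auto
    then show "z \<notin> Y" using \<open>reach g (f a) z\<close> unfolding Y_def by (auto dest: reach_in_trans)
  qed
  show "forest_fun N (mix g f Y)"
  proof (rule mix_forest[OF g f])
    fix a z assume *: "a \<in> Y" "g a \<notin> Y" "reach f (g a) z"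
    then have "\<not> reach f (g a) u" using b reach_cases[of g a b] unfolding Y_def by auto
    then show "z \<notin> Y" using *(3) unfolding Y_def by (auto dest: reach_in_trans)
  qed
qed

section \<open>Exchanging arcs between minimal forests\<close>

text \<open>
  What is used of the minimal \<open>k\<close>-forests: two swapped forests have the same total weight and the
  same total number of roots, so they are minimal if the root counts agree; root counts
  \<open>k - 1\<close> and \<open>k + 1\<close> would contradict the strict inequality between the weights.
\<close>

locale exchange_family =
  fixes N :: "'a set" and M :: "('a \<Rightarrow> 'a) set" and k :: nat
  assumes finite_N: "finite N"
    and forest_M: "f \<in> M \<Longrightarrow> forest_fun N f"
    and card_M: "f \<in> M \<Longrightarrow> card (N \<inter> fixes_of f) = k"
    and exchange: "f \<in> M \<Longrightarrow> g \<in> M \<Longrightarrow> A \<subseteq> N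
      \<Longrightarrow> forest_fun N (mix f g A) \<Longrightarrow> forest_fun N (mix g f A)
      \<Longrightarrow> card (A \<inter> fixes_of f) = card (A \<inter> fixes_of g) \<Longrightarrow> mix f g A \<in> M"
    and gap: "f \<in> M \<Longrightarrow> g \<in> M \<Longrightarrow> A \<subseteq> N
      \<Longrightarrow> forest_fun N (mix f g A) \<Longrightarrow> forest_fun N (mix g f A)
      \<Longrightarrow> card (A \<inter> fixes_of g) \<noteq> card (A \<inter> fixes_of f) + 1"
begin

section \<open>Exchanging along a whole tree of a minimal forest\<close>

definition tree_of :: "('a \<Rightarrow> 'a) \<Rightarrow> 'a \<Rightarrow> 'a set" where
  "tree_of f x = {y. root_of f y = root_of f x}"

lemma tree_of_reach: "f \<in> M \<Longrightarrow> reach f y z \<Longrightarrow> y \<in> tree_of f x \<longleftrightarrow> z \<in> tree_of f x"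
  using root_of_reach[OF forest_M] by (auto simp: tree_of_def)

lemma tree_of_step: "f \<in> M \<Longrightarrow> f y \<in> tree_of f x \<longleftrightarrow> y \<in> tree_of f x"
  using tree_of_reach[of f y "f y" x] reach_step by metis

lemma tree_of_subset:
  assumes "f \<in> M" "x \<in> N" shows "tree_of f x \<subseteq> N"
proof
  fix y assume "y \<in> tree_of f x"
  then have "root_of f y = root_of f x" by (simp add: tree_of_def)
  then show "y \<in> N" using root_of(1)[OF forest_M[OF assms(1)]] reach_in_N[OF forest_M[OF assms(1)]] assms(2)
    by metis
qed

text \<open>No \<open>g\<close>-arc crosses the boundary of a tree of \<open>g\<close>, so in both
  mixtures the set is left at most once.\<close>

lemma mix_tree_forest:
  assumes "f \<in> M" "g \<in> M"
  shows "forest_fun N (mix f g (tree_of g x))" "forest_fun N (mix g f (tree_of g x))"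
proof -
  note fg = assms forest_M[OF assms(1)] forest_M[OF assms(2)]
  show "forest_fun N (mix f g (tree_of g x))"
    by (rule mix_forest) (use fg tree_of_reach in metis)+
  show "forest_fun N (mix g f (tree_of g x))"
    by (rule mix_forest) (use fg tree_of_step in metis)+
qed

lemma tree_roots:
  assumes "f \<in> M" "x \<in> N"
  shows "tree_of f x \<inter> fixes_of f = {root_of f x}"
proof -
  have "root_of f r = r" if "f r = r" for r using that root_ofI by (metis reach_in.refl)
  then show ?thesis using root_of[OF forest_M[OF assms(1)], of x] by (auto simp: tree_of_def fixes_of_def)
qed

text \<open>By \<open>gap\<close>, no tree of \<open>g\<close> is without a root of
  \<open>f\<close>. Hence \<open>root_of g\<close> maps the \<open>k\<close> roots of
  \<open>f\<close> onto the \<open>k\<close> roots of \<open>g\<close>, and so injectively.\<close>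

lemma card_tree_roots:
  assumes f: "f \<in> M" and g: "g \<in> M" and x: "x \<in> N"
  shows "card (tree_of g x \<inter> fixes_of f) = 1"
proof -
  let ?R = "\<lambda>f. N \<inter> fixes_of f"
  have fin: "finite (?R f)" "finite (?R g)" using finite_N by auto
  have "root_of g ` ?R f = ?R g"
  proof
    show "root_of g ` ?R f \<subseteq> ?R g"
      using root_of[OF forest_M[OF g]] reach_in_N[OF forest_M[OF g]] by (auto simp: fixes_of_def)
    show "?R g \<subseteq> root_of g ` ?R f"
    proof
      fix r assume r: "r \<in> ?R g"
      then have sub: "tree_of g r \<subseteq> N" using tree_of_subset g by blast
      have "card (tree_of g r \<inter> fixes_of g) = 1" using tree_roots[OF g] r by simp
      then have "tree_of g r \<inter> fixes_of f \<noteq> {}"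
        using gap[OF f g sub] mix_tree_forest[OF f g] by force
      then obtain s where s: "s \<in> tree_of g r" "s \<in> fixes_of f" by blast
      have "root_of g r = r" using r root_ofI by (metis (mono_tags, lifting) Int_iff fixes_of_def mem_Collect_eq reach_in.refl)
      then show "r \<in> root_of g ` ?R f" using s sub by (force simp: tree_of_def)
    qed
  qed
  then have "inj_on (root_of g) (?R f)" using fin card_M[OF f] card_M[OF g] by (intro eq_card_imp_inj_on) auto
  moreover have "root_of g x \<in> root_of g ` ?R f"
    using \<open>root_of g ` ?R f = ?R g\<close> root_of[OF forest_M[OF g], of x] reach_in_N[OF forest_M[OF g]] x
    by (simp add: fixes_of_def)
  then obtain s where s: "s \<in> ?R f" "root_of g x = root_of g s" by auto
  ultimately have "tree_of g x \<inter> fixes_of f = {s}"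
    using tree_of_subset[OF g x] by (auto simp: tree_of_def inj_on_def)
  then show ?thesis by simp
qed

lemma mix_tree_in:
  assumes "f \<in> M" "g \<in> M" "x \<in> N"
  shows "mix f g (tree_of g x) \<in> M"
  using assms by (intro exchange tree_of_subset mix_tree_forest) (auto simp: card_tree_roots)

text \<open>Recording the last vertex inside the tree, not the first one outside, distinguishes
  paths that leave by different arcs with the same end.\<close>

definition exits :: "('a \<Rightarrow> 'a) \<Rightarrow> ('a \<Rightarrow> 'a) \<Rightarrow> 'a \<Rightarrow> 'a \<Rightarrow> bool" where
  "exits g h e u \<longleftrightarrow> reach_in (tree_of g e) h e u \<and> u \<in> tree_of g e \<and> h u \<notin> tree_of g e"

lemma tree_of_self [simp]: "x \<in> tree_of g x"
  by (simp add: tree_of_def)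

lemma tree_of_eq: "root_of g x = root_of g y \<Longrightarrow> tree_of g x = tree_of g y"
  by (simp add: tree_of_def)

lemma reach_root_iff:
  assumes "g \<in> M" shows "reach g y (root_of g x) \<longleftrightarrow> y \<in> tree_of g x"
  using root_of[OF forest_M[OF assms], of x] root_of[OF forest_M[OF assms], of y]
    root_ofI[of g y "root_of g x"] by (auto simp: tree_of_def)

text \<open>Outside the tree \<open>h\<close> agrees with \<open>g\<close>, and no
  \<open>g\<close>-arc enters the tree from outside.\<close>

lemma no_return:
  assumes g: "g \<in> M" and agree: "{z. h z \<noteq> g z} \<subseteq> tree_of g x"
    and yz: "reach h y z" "y \<notin> tree_of g x"
  shows "z \<notin> tree_of g x"
proof -
  have "h w \<in> - tree_of g x" if "w \<in> - tree_of g x" for w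
    using that agree tree_of_step[OF g, of w x] by (cases "h w = g w") auto
  then show ?thesis using reach_invariant[OF yz(1), of "- tree_of g x"] yz(2) by blast
qed

text \<open>No root of \<open>h\<close> lies in \<open>Y\<close>, since it would have to be
  \<open>u\<close>, and the only possible root of \<open>g\<close> in \<open>Y\<close> is
  \<open>b\<close>. If the \<open>h\<close>-path of \<open>b\<close> passed \<open>u\<close>, then
  \<open>b\<close> would be such a root and the counts 1 and 0 would contradict \<open>gap\<close>.
  So \<open>Y\<close> contains no roots at all and the exchange preserves minimality.\<close>

lemma exchange_between:
  assumes g: "g \<in> M" and h: "h \<in> M" and x: "x \<in> N"
    and u: "u \<in> tree_of g x" "h u \<notin> tree_of g x"
    and Z: "b \<in> tree_of g x" "g b = b \<or> \<not> reach h b u"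
  defines "Y \<equiv> {z. reach h z u \<and> reach g z b}"
  shows "Y \<subseteq> N" "mix h g Y \<in> M" "mix g h Y \<in> M" "\<not> reach h b u"
proof -
  have YD: "Y \<subseteq> tree_of g x" using Z(1) tree_of_reach[OF g] unfolding Y_def by blast
  then show YN: "Y \<subseteq> N" using tree_of_subset[OF g x] by blast
  have nr: "\<not> reach g (h u) b" using tree_of_reach[OF g] u Z(1) by blast
  note mf = mix_forest_swap[OF forest_M[OF h] forest_M[OF g] nr Z(2), folded Y_def]
  have "h u \<noteq> u" using u by metis
  then have hY: "Y \<inter> fixes_of h = {}" unfolding Y_def fixes_of_def using reach_fixed[of h _ u] by auto
  have gY: "Y \<inter> fixes_of g \<subseteq> {b}" unfolding Y_def fixes_of_def using reach_fixed[of g _ b] by auto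
  show nb: "\<not> reach h b u"
  proof
    assume "reach h b u"
    then have "Y \<inter> fixes_of g = {b}" using gY Z(2) by (auto simp: Y_def fixes_of_def)
    then show False using gap[OF h g YN mf] hY by simp
  qed
  then have "Y \<inter> fixes_of g = {}" using gY by (auto simp: Y_def)
  then have c: "card (Y \<inter> fixes_of h) = card (Y \<inter> fixes_of g)" by (simp only: hY)
  show "mix h g Y \<in> M" by (rule exchange[OF h g YN mf c])
  show "mix g h Y \<in> M" by (rule exchange[OF g h YN mf(2,1) c[symmetric]])
qed

text \<open>The path must leave the smaller tree no later than the larger one, because after
  \<open>u\<close> it never comes back.\<close>

lemma exit_exists:
  assumes g: "g \<in> M" and agree: "{z. h z \<noteq> g z} \<subseteq> tree_of g x"
    and sub: "tree_of g' e \<subseteq> tree_of g x"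
    and u: "reach h e u" "u \<in> tree_of g x" "h u \<notin> tree_of g x"
  obtains v where "exits g' h e v" "reach h v u"
proof -
  have "reach h e (h u)" "h u \<notin> tree_of g' e" using reach_step_right[OF u(1)] u(3) sub by auto
  then obtain b where b: "b \<notin> tree_of g' e" "reach_in (tree_of g' e) h e b"
    by (rule reach_exit)
  then have "e \<noteq> b" by auto
  then obtain v where v: "v \<in> tree_of g' e" "b = h v" "reach_in (tree_of g' e) h e v"
    using reach_in_last[OF b(2)] by blast
  have "reach h v u \<or> reach h u v" using reach_linear[OF u(1) reach_in_imp_reach[OF v(3)]] by auto
  moreover have "reach h v u" if "reach h u v"
    using reach_cases[OF that] no_return[OF g agree _ u(3)] v(1) sub by auto
  ultimately show ?thesis using that b v by (auto simp: exits_def)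
qed

text \<open>One half of the induction step for unique exits. If the \<open>g\<close>-path of
  \<open>e2\<close> avoided \<open>Y\<close>, then \<open>g'\<close> would be closer to
  \<open>h\<close> and still have two different exits, against \<open>IH\<close>.\<close>

lemma exit_blocked:
  fixes g h :: "'a \<Rightarrow> 'a"
  assumes g: "g \<in> M" and h: "h \<in> M" and N: "e1 \<in> N"
    and same: "\<forall>f\<in>M. root_of f e1 = root_of f e2"
    and agree: "{z. h z \<noteq> g z} \<subseteq> tree_of g e1"
    and u1: "exits g h e1 u1" and u2: "exits g h e2 u2" and ne: "u1 \<noteq> u2"
    and IH: "\<forall>g'\<in>M. {w. g' w \<noteq> h w} \<subset> {w. g w \<noteq> h w}
      \<longrightarrow> (\<forall>v1 v2. exits g' h e1 v1 \<longrightarrow> exits g' h e2 v2 \<longrightarrow> v1 = v2)"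
  obtains b y where "reach_in {w. reach h w u1} g e1 b" "\<not> reach h b u1"
    "reach g e2 y" "reach h y u1" "reach g y b"
proof -
  define D where "D = tree_of g e1"
  have D2: "tree_of g e2 = D" using same g tree_of_eq[of g e1 e2] by (simp add: D_def)
  define B where "B = {w. reach h w u1}"
  have ru: "reach h e1 u1" "reach h e2 u2" using u1 u2 reach_in_imp_reach unfolding exits_def by metis+
  have uD: "u1 \<in> D" "h u1 \<notin> D" "u2 \<in> D" "h u2 \<notin> D" using u1 u2 D2 by (auto simp: exits_def D_def)
  let ?r = "root_of g e1"
  have r: "reach g e1 ?r" "g ?r = ?r" using root_of[OF forest_M[OF g]] by auto
  then have rD: "?r \<in> D" using tree_of_reach[OF g, of e1 ?r e1] by (simp add: D_def)
  \<comment> \<open>The case \<open>b = ?r\<close> of the exchange shows that the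
    \<open>g\<close>-path of \<open>e1\<close> must leave \<open>B\<close>.\<close>
  have "?r \<notin> B"
    using exchange_between(4)[OF g h N _ _ _ disjI1[OF r(2)], of u1] uD rD by (auto simp: D_def B_def)
  then obtain b where b: "b \<notin> B" "reach_in B g e1 b" using reach_exit[OF r(1)] by metis
  define Y where "Y = {z. reach h z u1 \<and> reach g z b}"
  have bD: "b \<in> D" using reach_in_imp_reach[OF b(2)] tree_of_reach[OF g] tree_of_self unfolding D_def by metis
  have "\<not> reach h b u1" using b by (simp add: B_def)
  note sw = exchange_between[OF g h N uD(1,2)[unfolded D_def] bD[unfolded D_def] disjI2[OF this], folded Y_def]
  define g' where "g' = mix h g Y"
  have g': "g' \<in> M" using sw g'_def by simp
  have YD: "Y \<subseteq> D" using bD tree_of_reach[OF g] unfolding Y_def D_def by blast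
  have "\<exists>y. reach g e2 y \<and> y \<in> Y"
  proof (rule ccontr)
    assume no: "\<not> ?thesis"
    have "?r = root_of g e2" using same g by simp
    then have r2: "reach g e2 ?r" using root_of(1)[OF forest_M[OF g], of e2] by simp
    have "reach_in (- Y) g e2 ?r"
      using reach_first_exit[OF r2, of "- Y"] no reach_in_imp_reach[of "- Y" g e2] by auto
    then have "reach g' e2 ?r" unfolding g'_def by (rule reach_in_mix_compl)
    moreover have "g' ?r = ?r" using no r2 r(2) by (auto simp: g'_def mix_def)
    ultimately have "root_of g' e2 = ?r" by (rule root_ofI)
    \<comment> \<open>The path of \<open>e1\<close> did change. Its root is known only because
      \<open>g'\<close> is minimal, so that \<open>same\<close> transfers the root of
      \<open>e2\<close>.\<close>
    then have root': "root_of g' e1 = ?r" "root_of g' e2 = ?r" using same g' by auto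
    have sub: "tree_of g' e1 \<subseteq> D"
    proof
      fix z assume "z \<in> tree_of g' e1"
      then have "reach g' z ?r" using reach_root_iff[OF g'] root'(1) by metis
      moreover have "{w. g' w \<noteq> g w} \<subseteq> tree_of g e1" using YD by (auto simp: g'_def mix_def D_def)
      ultimately show "z \<in> D" using no_return[OF g, of g' e1 z ?r] rD unfolding D_def by blast
    qed
    moreover have "tree_of g' e2 = tree_of g' e1" by (rule tree_of_eq) (simp add: root')
    ultimately have sub: "tree_of g' e1 \<subseteq> tree_of g e1" "tree_of g' e2 \<subseteq> tree_of g e1"
      by (simp_all add: D_def)
    note uD' = uD[unfolded D_def]
    obtain v1 where v1: "exits g' h e1 v1" "reach h v1 u1"
      by (rule exit_exists[OF g agree sub(1) ru(1) uD'(1,2)])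
    obtain v2 where v2: "exits g' h e2 v2" "reach h v2 u2"
      by (rule exit_exists[OF g agree sub(2) ru(2) uD'(3,4)])
    note v = v1 v2
    \<comment> \<open>From a common exit the \<open>h\<close>-path would pass both \<open>u1\<close>
      and \<open>u2\<close>, hence return to the tree of \<open>g\<close> after leaving it.\<close>
    have "v1 \<noteq> v2"
    proof
      assume "v1 = v2"
      then have "reach h u1 u2 \<or> reach h u2 u1" using v reach_linear[of h v1 u1 u2] by simp
      then have "reach h (h u1) u2 \<or> reach h (h u2) u1"
        using ne reach_cases[of h u1 u2] reach_cases[of h u2 u1] by auto
      then show False using no_return[OF g agree, of "h u1" u2] no_return[OF g agree, of "h u2" u1] uD'
        by auto
    qed
    moreover have "{w. g' w \<noteq> h w} \<subset> {w. g w \<noteq> h w}"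
    proof -
      have "e1 \<in> B" using ru by (simp add: B_def)
      \<comment> \<open>The vertex \<open>a\<close> just before \<open>b\<close> witnesses
        strictness. If \<open>h a\<close> were \<open>b\<close>, outside \<open>B\<close>, then
        \<open>a = u1\<close>; but \<open>h u1\<close> lies outside \<open>D\<close> and
        \<open>b\<close> inside.\<close>
      then obtain a where a: "a \<in> B" "b = g a" "reach_in B g e1 a" using reach_in_last[OF b(2)] b(1) by metis
      have "a \<in> Y" using a reach_step by (auto simp: Y_def B_def)
      moreover have "g a \<noteq> h a"
      proof
        assume *: "g a = h a"
        have "a = u1" using a b reach_cases[of h a u1] * by (auto simp: B_def)
        then show False using * a(2) bD uD by simp
      qed
      moreover have "g' a = h a" using \<open>a \<in> Y\<close> by (simp add: g'_def mix_def)
      ultimately show ?thesis by (auto simp: g'_def mix_def)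
    qed
    ultimately show False using IH g' v by blast
  qed
  then obtain y where "reach g e2 y" "reach h y u1" "reach g y b" by (auto simp: Y_def)
  then show ?thesis using that b unfolding B_def by blast
qed

text \<open>
  The induction is on the number of vertices at which \<open>g\<close> and \<open>h\<close> differ. If it cannot proceed,
  \<open>exit_blocked\<close> applies in both directions and produces a circuit of \<open>g\<close> through \<open>b1\<close> and \<open>b2\<close>.
\<close>

lemma exit_unique:
  assumes "g \<in> M" and "h \<in> M" and N: "e1 \<in> N" "e2 \<in> N"
    and same: "\<forall>f\<in>M. root_of f e1 = root_of f e2"
    and "exits g h e1 u1" and "exits g h e2 u2"
  shows "u1 = u2"
  using assms(1,2,6,7)
proof (induction "card {w. g w \<noteq> h w}" arbitrary: g h u1 u2 rule: less_induct)
  case less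
  note g = less.prems(1) and h = less.prems(2)
  have fin: "finite {w. g w \<noteq> h w}"
  proof (rule finite_subset[OF _ finite_N])
    show "{w. g w \<noteq> h w} \<subseteq> N"
    proof
      fix w assume "w \<in> {w. g w \<noteq> h w}"
      then show "w \<in> N"
        using forest_funD(1)[OF forest_M[OF g], of w] forest_funD(1)[OF forest_M[OF h], of w] by (cases "w \<in> N") auto
    qed
  qed
  define D where "D = tree_of g e1"
  have D2: "tree_of g e2 = D" using same g tree_of_eq[of g e1 e2] by (simp add: D_def)
  \<comment> \<open>Making \<open>h\<close> agree with \<open>g\<close> outside \<open>D\<close>
    keeps it minimal, keeps both exits, and adds no vertex of disagreement.\<close>
  define h' where "h' = mix h g D"
  have h': "h' \<in> M" using mix_tree_in[OF h g N(1)] by (simp add: h'_def D_def)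
  have agree: "{z. h' z \<noteq> g z} \<subseteq> D" by (auto simp: h'_def mix_def)
  have onD: "\<And>z. z \<in> D \<Longrightarrow> h' z = h z" by (simp add: h'_def mix_def)
  have ex: "exits g h' e1 u1" "exits g h' e2 u2"
    using less.prems(3,4) onD D2 reach_in_cong[of D h _ _ h'] unfolding exits_def D_def by auto
  have IH: "v1 = v2" if "g' \<in> M" "{w. g' w \<noteq> h' w} \<subset> {w. g w \<noteq> h' w}"
      "exits g' h' e1 v1" "exits g' h' e2 v2" for g' v1 v2
  proof -
    have "{w. g w \<noteq> h' w} \<subseteq> {w. g w \<noteq> h w}" by (auto simp: h'_def mix_def)
    then have "{w. g' w \<noteq> h' w} \<subset> {w. g w \<noteq> h w}" using that(2) by (rule psubset_subset_trans[rotated])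
    then have "card {w. g' w \<noteq> h' w} < card {w. g w \<noteq> h w}" using fin by (intro psubset_card_mono)
    then show ?thesis using less.hyps[OF _ that(1) h' that(3,4)] by blast
  qed
  show ?case
  proof (rule ccontr)
    assume ne: "u1 \<noteq> u2"
    have same': "\<forall>f\<in>M. root_of f e2 = root_of f e1" using same by simp
    have IH1: "\<forall>g'\<in>M. {w. g' w \<noteq> h' w} \<subset> {w. g w \<noteq> h' w}
      \<longrightarrow> (\<forall>v1 v2. exits g' h' e1 v1 \<longrightarrow> exits g' h' e2 v2 \<longrightarrow> v1 = v2)" using IH by blast
    have IH2: "\<forall>g'\<in>M. {w. g' w \<noteq> h' w} \<subset> {w. g w \<noteq> h' w}
      \<longrightarrow> (\<forall>v1 v2. exits g' h' e2 v1 \<longrightarrow> exits g' h' e1 v2 \<longrightarrow> v1 = v2)" using IH by blast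
    obtain b1 y1 where 1: "reach_in {w. reach h' w u1} g e1 b1" "\<not> reach h' b1 u1"
        "reach g e2 y1" "reach h' y1 u1" "reach g y1 b1"
      by (rule exit_blocked[OF g h' N(1) same agree[unfolded D_def] ex ne IH1])
    obtain b2 y2 where 2: "reach_in {w. reach h' w u2} g e2 b2" "\<not> reach h' b2 u2"
        "reach g e1 y2" "reach h' y2 u2" "reach g y2 b2"
      by (rule exit_blocked[OF g h' N(2) same' agree[folded D2] ex(2,1) ne[symmetric] IH2])
    have ru: "u1 \<in> D" "h' u1 \<notin> D" "u2 \<in> D" "h' u2 \<notin> D"
      using ex D2 by (auto simp: exits_def D_def)
    note nr = no_return[OF g agree[unfolded D_def], folded D_def]
    have disj: "\<not> reach h' y u2" if y: "reach h' y u1" for y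
    proof
      assume "reach h' y u2"
      then have "reach h' u1 u2 \<or> reach h' u2 u1" using reach_linear[OF y] by simp
      then have "reach h' (h' u1) u2 \<or> reach h' (h' u2) u1"
        using ne reach_cases[of h' u1 u2] reach_cases[of h' u2 u1] by auto
      then show False using nr[of "h' u1" u2] nr[of "h' u2" u1] ru by auto
    qed
    \<comment> \<open>All vertices strictly before \<open>b\<close> on the path lie in
      \<open>S\<close>, so a vertex of the path outside \<open>S\<close> is not before
      \<open>b\<close>.\<close>
    have late: "reach g b y" if "reach_in S g e b" "reach g e y" "y \<notin> S" for S b y e
    proof -
      have "reach g b y \<or> y = b \<or> y \<in> S"
        using that(1,2)
      proof (induction rule: reach_in.induct)
        case (step z)
        then show ?case using reach_cases by metis
      qed auto
      then show ?thesis using that(3) by auto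
    qed
    \<comment> \<open>This closes the circuit \<open>y1\<close>, \<open>b1\<close>,
      \<open>y2\<close>, \<open>b2\<close>, \<open>y1\<close> of \<open>g\<close>. It forces
      \<open>y1 = b1\<close>, yet only \<open>y1\<close> reaches \<open>u1\<close> under
      \<open>h'\<close>.\<close>
    have "reach g b2 y1" using late[OF 2(1) 1(3)] disj 1(4) by blast
    moreover have "reach g b1 y2" using late[OF 1(1) 2(3)] disj 2(4) by blast
    ultimately have "reach g y1 b1" "reach g b1 y1" using 1(5) 2(5) reach_in_trans by metis+
    then have "y1 = b1" using forest_reach_antisym[OF forest_M[OF g]] by blast
    then show False using 1 by simp
  qed
qed

text \<open>The vertices \<open>x\<close> and \<open>y\<close> are the candidates for roots of the
  forest induced on \<open>E\<close>. Each lies on the path of every vertex of \<open>E\<close>, so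
  they reach each other and coincide.\<close>

lemma atom_single_exit:
  assumes f: "f \<in> M" and E: "E \<subseteq> N"
    and same: "\<And>x y g. x \<in> E \<Longrightarrow> y \<in> E \<Longrightarrow> g \<in> M \<Longrightarrow> root_of g x = root_of g y"
    and sep: "\<And>x z. x \<in> E \<Longrightarrow> z \<in> N \<Longrightarrow> z \<notin> E \<Longrightarrow> \<exists>g\<in>M. root_of g x \<noteq> root_of g z"
    and x: "x \<in> E" "f x = x \<or> f x \<notin> E" and y: "y \<in> E" "f y = y \<or> f y \<notin> E"
  shows "x = y"
proof -
  have main: "reach f y x" if x: "x \<in> E" "f x = x \<or> f x \<notin> E" and y: "y \<in> E" for x y
  proof (cases "f x = x")
    case True
    then have "root_of f x = x" using root_ofI by (metis reach_in.refl)
    then show ?thesis using same[OF x(1) y f] root_of(1)[OF forest_M[OF f], of y] by simp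
  next
    case False
    then have "f x \<in> N" "f x \<notin> E" using x E forest_funD(2)[OF forest_M[OF f]] by auto
    then obtain g where g: "g \<in> M" "root_of g x \<noteq> root_of g (f x)" using sep x(1) by metis
    define D where "D = tree_of g x"
    have D2: "tree_of g y = D" using same[OF x(1) y g(1)] tree_of_eq unfolding D_def by metis
    have fx: "f x \<notin> D" using g by (simp add: D_def tree_of_def)
    define h where "h = mix f g D"
    have xN: "x \<in> N" "y \<in> N" using x y E by auto
    have h: "h \<in> M" using mix_tree_in[OF f g(1) xN(1)] by (simp add: h_def D_def)
    have agree: "{z. h z \<noteq> g z} \<subseteq> D" by (auto simp: h_def mix_def)
    have onD: "\<And>z. z \<in> D \<Longrightarrow> h z = f z" by (simp add: h_def mix_def)
    have xD: "x \<in> D" "y \<in> D" using D2 tree_of_self[of y g] by (simp_all add: D_def)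
    let ?r = "root_of h x"
    have "reach h x (f x)" using onD[OF xD(1)] reach_step by metis
    then have "?r = root_of h (f x)" using root_of_reach[OF forest_M[OF h]] by metis
    then have "reach h (f x) ?r" using root_of(1)[OF forest_M[OF h], of "f x"] by simp
    \<comment> \<open>The root common to \<open>x\<close> and \<open>y\<close> under
      \<open>h\<close> lies outside \<open>D\<close>, so the path of \<open>y\<close> leaves
      \<open>D\<close> as well. Since \<open>x\<close> exits at \<open>x\<close> itself, unique
      exits put \<open>x\<close> on the path of \<open>y\<close>.\<close>
    then have "?r \<notin> D" using no_return[OF g(1) agree[unfolded D_def], of "f x" ?r] fx by (simp add: D_def)
    moreover have "reach h y ?r"
      using root_of(1)[OF forest_M[OF h], of y] same[OF x(1) y h] by simp
    ultimately obtain b where b: "b \<notin> D" "reach_in D h y b" using reach_exit by metis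
    then obtain u where u: "u \<in> D" "b = h u" "reach_in D h y u"
      using reach_in_last xD by metis
    have "exits g h y u" using u b D2 by (simp add: exits_def)
    moreover have "exits g h x x" using xD fx onD by (simp add: exits_def D_def)
    moreover have "\<forall>g\<in>M. root_of g y = root_of g x" using same[OF y x(1)] by blast
    ultimately have "u = x" using exit_unique[OF g(1) h xN(2,1)] by blast
    moreover have "reach_in D f y u" using u(3) reach_in_cong[of D h y u f] onD by metis
    ultimately show ?thesis using reach_in_imp_reach by metis
  qed
  show ?thesis using main[OF x y(1)] main[OF y x(1)] forest_reach_antisym[OF forest_M[OF f]] by blast
qed

end

section \<open>Parent maps and digraphs\<close>

text \<open>Fixed points produce no arc, because a loop would be a circuit. Arcs are pairs with
  projections, as in \<open>with_proj\<close>.\<close>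

definition fgraph :: "'a set \<Rightarrow> ('a \<Rightarrow> 'a) \<Rightarrow> ('a, 'a \<times> 'a) pre_digraph" where
  "fgraph N f = \<lparr>verts = N, arcs = {(x, f x) | x. x \<in> N \<and> f x \<noteq> x}, tail = fst, head = snd\<rparr>"

lemma fgraph_simps [simp]:
  "verts (fgraph N f) = N" "tail (fgraph N f) = fst" "head (fgraph N f) = snd"
  "arcs (fgraph N f) = {(x, f x) | x. x \<in> N \<and> f x \<noteq> x}"
  by (simp_all add: fgraph_def)

lemma arcs_ends_fst_snd: "tail G = fst \<Longrightarrow> head G = snd \<Longrightarrow> arcs_ends G = arcs G"
  by (simp add: arcs_ends_def arc_to_ends_def)

lemma wf_fgraph: "(\<And>x. x \<in> N \<Longrightarrow> f x \<in> N) \<Longrightarrow> wf_digraph (fgraph N f)"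
  by unfold_locales auto

lemma fgraph_cas_reach:
  "set p \<subseteq> arcs (fgraph N f) \<Longrightarrow> pre_digraph.cas (fgraph N f) u p w \<Longrightarrow> reach f u w"
proof (induction p arbitrary: u)
  case Nil
  then show ?case by (simp add: pre_digraph.cas.simps)
next
  case (Cons e p)
  then have "reach f (f u) w"
    by (auto simp: pre_digraph.cas.simps intro!: Cons.IH)
  then show ?case by (rule reach_step_left)
qed

lemma in_forest_fgraph:
  assumes f: "forest_fun N f" and N: "finite N"
  shows "in_forest (fgraph N f)"
proof -
  let ?G = "fgraph N f"
  interpret wf_digraph ?G using forest_funD(2)[OF f] by (rule wf_fgraph)
  have arcs: "arcs ?G = (\<lambda>x. (x, f x)) ` {x \<in> N. f x \<noteq> x}" by auto
  have fin: "fin_digraph ?G" by unfold_locales (use N arcs in auto)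
  have "\<not> pre_digraph.cycle ?G p" for p
  proof
    assume "pre_digraph.cycle ?G p"
    then obtain u where p: "pre_digraph.awalk ?G u p u" "p \<noteq> []" by (auto simp: pre_digraph.cycle_def)
    then obtain e q where "p = e # q" by (cases p) auto
    then have e: "f u \<noteq> u" "set q \<subseteq> arcs ?G" "pre_digraph.cas ?G (f u) q u"
      using p(1) by (auto simp: pre_digraph.awalk_def pre_digraph.cas.simps)
    then show False using forest_reach_antisym[OF f fgraph_cas_reach[OF e(2,3)] reach_step] by simp
  qed
  moreover have "out_degree ?G u \<le> 1" for u
  proof -
    have "out_arcs ?G u \<subseteq> {(u, f u)}" by (auto simp: out_arcs_def)
    then have "card (out_arcs ?G u) \<le> card {(u, f u)}" by (rule card_mono[rotated]) simp
    then show ?thesis by (simp add: out_degree_def)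
  qed
  ultimately show ?thesis using fin by (auto simp: in_forest_def Digraph_Component.forest_def)
qed

text \<open>Outdegree at most 1 makes the successor a function. The converse of a finite acyclic arc
  set is well-founded, so following arcs ends at a fixed point.\<close>

lemma in_forest_eq_fgraph:
  assumes G: "in_forest G" and ends: "tail G = fst" "head G = snd"
  obtains f where "forest_fun (verts G) f" "G = fgraph (verts G) f"
proof -
  interpret fin_digraph G using G by (simp add: in_forest_def)
  define f where "f x = (if \<exists>y. (x, y) \<in> arcs G then SOME y. (x, y) \<in> arcs G else x)" for x
  have fI: "(x, f x) \<in> arcs G" if "(x, y) \<in> arcs G" for x y
    using someI[of "\<lambda>y. (x, y) \<in> arcs G" y] that by (auto simp: f_def)
  have nocycle: "\<not> cycle p" for p using G by (simp add: in_forest_def Digraph_Component.forest_def)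
  have fu: "y = f x" if xy: "(x, y) \<in> arcs G" for x y
  proof -
    have "x \<in> verts G" using tail_in_verts[OF xy] ends by simp
    then have "card (out_arcs G x) \<le> 1" using G by (simp add: in_forest_def out_degree_def)
    moreover have "finite (out_arcs G x)" by (rule finite_subset[OF _ finite_arcs]) (auto simp: out_arcs_def)
    ultimately have "\<forall>a\<in>out_arcs G x. \<forall>b\<in>out_arcs G x. a = b"
      using card_le_Suc0_iff_eq[of "out_arcs G x"] by simp
    moreover have "(x, y) \<in> out_arcs G x" "(x, f x) \<in> out_arcs G x"
      using xy fI[OF xy] ends by (auto simp: out_arcs_def)
    ultimately have "(x, y) = (x, f x)" by blast
    then show ?thesis by simp
  qed
  have ae: "arcs_ends G = arcs G" using ends by (rule arcs_ends_fst_snd)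
  have acyc: "acyclic (arcs G)"
  proof (rule acyclicI, rule allI, rule notI)
    fix x assume "(x, x) \<in> (arcs G)\<^sup>+"
    then obtain p where "awalk x p x" "p \<noteq> []" using reachable1_awalk[of x x] ae by auto
    then have "closed_w p" by (auto simp: closed_w_def)
    then show False using closed_w_imp_cycle nocycle by blast
  qed
  have loop: "f x \<noteq> x" if "(x, y) \<in> arcs G" for x y
    using acyc fI[OF that] by (metis acyclic_def r_into_trancl')
  have verts: "f x \<in> verts G" if "x \<in> verts G" for x
  proof (cases "\<exists>y. (x, y) \<in> arcs G")
    case True
    then show ?thesis using head_in_verts[OF fI] ends by auto
  qed (use that in \<open>simp add: f_def\<close>)
  have out: "f x = x" if "x \<notin> verts G" for x
  proof -
    have "\<nexists>y. (x, y) \<in> arcs G" using tail_in_verts that ends by fastforce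
    then show ?thesis by (simp add: f_def)
  qed
  have step: "(x, f x) \<in> arcs G" if "f x \<noteq> x" for x
    using that fI by (metis f_def)
  have "wf ((arcs G)\<inverse>)" using finite_acyclic_wf_converse[OF finite_arcs acyc] .
  then have "\<exists>r. reach f x r \<and> f r = r" for x
  proof (induction x rule: wf_induct_rule)
    case (less x)
    show ?case
    proof (cases "f x = x")
      case False
      then have "\<exists>r. reach f (f x) r \<and> f r = r" using less[of "f x"] step by simp
      then show ?thesis using reach_step_left[of f x] by blast
    qed auto
  qed
  then have "forest_fun (verts G) f" using out verts by (simp add: forest_fun_def)
  moreover have "arcs G = {(x, f x) | x. x \<in> verts G \<and> f x \<noteq> x}"
    using fu loop step tail_in_verts ends by fastforce
  then have "G = fgraph (verts G) f" using ends by (simp add: fgraph_def)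
  ultimately show ?thesis using that by blast
qed

section \<open>Weak components correspond to roots\<close>

definition component :: "('a \<Rightarrow> 'a) \<Rightarrow> 'a \<Rightarrow> ('a, 'a \<times> 'a) pre_digraph" where
  "component f r = fgraph {x. root_of f x = r} f"

text \<open>Each vertex is joined to \<open>r\<close> by its own path, which the symmetric closure
  can traverse backwards.\<close>

lemma component_connected:
  assumes f: "forest_fun N f" and r: "f r = r"
  shows "Digraph_Component.connected (component f r)"
proof -
  let ?T = "{x. root_of f x = r}" and ?R = "(arcs_ends (component f r))\<^sup>s"
  have ae: "arcs_ends (component f r) = arcs (component f r)"
    by (rule arcs_ends_fst_snd) (simp_all add: component_def)
  have rT: "r \<in> ?T" using root_ofI[of f r r] r by simp
  have step: "f x \<in> ?T" if "x \<in> ?T" for x using that root_of_reach[OF f reach_step, of x] by simp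
  have sym: "sym ?R" by (auto simp: sym_def symcl_def)
  have up: "(u, w) \<in> rtrancl_on ?T ?R" if "reach f u w" "u \<in> ?T" for u w
    using that
  proof (induction rule: reach_in.induct)
    case (step w)
    then have w: "w \<in> ?T" by (auto dest: in_rtrancl_on_in_F)
    then have "f w \<in> ?T" by (rule \<open>\<And>x. x \<in> ?T \<Longrightarrow> f x \<in> ?T\<close>)
    moreover have "(w, f w) \<in> ?R" if "f w \<noteq> w"
      using w that unfolding ae by (auto simp: component_def symcl_def)
    ultimately show ?case using step by (cases "f w = w") (auto intro: rtrancl_on_into_rtrancl_on)
  qed auto
  have toroot: "(u, r) \<in> rtrancl_on ?T ?R" if "u \<in> ?T" for u
    using up[OF root_of(1)[OF f] that] that by simp
  moreover have "(r, u) \<in> rtrancl_on ?T ?R" if "u \<in> ?T" for u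
    using rtrancl_on_converseI[OF toroot[OF that]] sym by (simp add: sym_conv_converse_eq)
  ultimately have "(u, w) \<in> rtrancl_on ?T ?R" if "u \<in> ?T" "w \<in> ?T" for u w
    using that rtrancl_on_trans by metis
  then show ?thesis using rT unfolding connected_conv by (auto simp: component_def)
qed

text \<open>Both ends of an arc have the same root, so the root is constant along undirected walks
  of \<open>H\<close>.\<close>

lemma connected_subgraph_component:
  assumes f: "forest_fun N f" and H: "Digraph_Component.connected H" "subgraph H (fgraph N f)"
  obtains r where "r \<in> N" "f r = r" "subgraph H (component f r)"
proof -
  have ends: "tail H = fst" "head H = snd" and wf: "wf_digraph H"
    and sub: "verts H \<subseteq> N" "arcs H \<subseteq> arcs (fgraph N f)"
    using H(2) by (auto simp: subgraph_def compatible_def)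
  have ae: "arcs_ends H = arcs H" using ends by (rule arcs_ends_fst_snd)
  obtain u where u: "u \<in> verts H" using H(1) unfolding connected_conv by auto
  let ?r = "root_of f u"
  have same: "root_of f w = ?r" if "w \<in> verts H" for w
  proof -
    have "(u, w) \<in> rtrancl_on (verts H) ((arcs H)\<^sup>s)"
      using H(1) u that unfolding connected_conv ae by auto
    then show ?thesis
    proof (induction rule: rtrancl_on_induct)
      case (step y z)
      then have "(y, z) \<in> arcs H \<or> (z, y) \<in> arcs H" by (auto simp: symcl_def)
      then have "z = f y \<or> y = f z" using sub(2) by auto
      then show ?case using step.IH root_of_reach[OF f reach_step] by metis
    qed simp
  qed
  have r: "f ?r = ?r" "?r \<in> N"
    using root_of[OF f, of u] reach_in_N[OF f] u sub by auto
  have "wf_digraph (component f ?r)" unfolding component_def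
    by (rule wf_fgraph) (use root_of_reach[OF f reach_step] in simp)
  moreover have "arcs H \<subseteq> arcs (component f ?r)"
  proof
    fix e assume e: "e \<in> arcs H"
    then have "fst e \<in> verts H" using wf_digraph.tail_in_verts[OF wf e] ends by simp
    then show "e \<in> arcs (component f ?r)" using sub(2) e same by (auto simp: component_def)
  qed
  ultimately have "subgraph H (component f ?r)"
    using same ends wf by (auto simp: subgraph_def compatible_def component_def)
  then show ?thesis using that r by blast
qed

lemma subgraph_antisym: "subgraph G H \<Longrightarrow> subgraph H G \<Longrightarrow> G = (H :: ('a, 'b) pre_digraph)"
  by (auto simp: subgraph_def compatible_def intro!: pre_digraph.equality)

lemma component_subgraph:
  assumes f: "forest_fun N f" and r: "r \<in> N"
  shows "subgraph (component f r) (fgraph N f)"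
proof -
  have "{x. root_of f x = r} \<subseteq> N" using root_of(1)[OF f] reach_in_N[OF f] r by blast
  moreover have "wf_digraph (component f r)" unfolding component_def
    by (rule wf_fgraph) (use root_of_reach[OF f reach_step] in simp)
  moreover have "wf_digraph (fgraph N f)" by (rule wf_fgraph) (rule forest_funD(2)[OF f])
  ultimately show ?thesis by (auto simp: subgraph_def compatible_def component_def)
qed

lemma weak_components_fgraph:
  assumes f: "forest_fun N f"
  shows "weak_components (fgraph N f) = component f ` (N \<inter> fixes_of f)"
proof
  show "weak_components (fgraph N f) \<subseteq> component f ` (N \<inter> fixes_of f)"
  proof
    fix H assume H: "H \<in> weak_components (fgraph N f)"
    then have "Digraph_Component.connected H" "subgraph H (fgraph N f)"
      by (auto simp: weak_components_def pre_digraph.max_subgraph_def)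
    then obtain r where r: "r \<in> N" "f r = r" "subgraph H (component f r)"
      by (rule connected_subgraph_component[OF f])
    then have "H = component f r"
      using H component_subgraph[OF f r(1)] component_connected[OF f r(2)]
      unfolding weak_components_def pre_digraph.max_subgraph_def by auto
    then show "H \<in> component f ` (N \<inter> fixes_of f)" using r by (simp add: fixes_of_def)
  qed
  show "component f ` (N \<inter> fixes_of f) \<subseteq> weak_components (fgraph N f)"
  proof
    fix H assume "H \<in> component f ` (N \<inter> fixes_of f)"
    then obtain r where r: "r \<in> N" "f r = r" "H = component f r" by (auto simp: fixes_of_def)
    \<comment> \<open>A connected extension lies in a single component. It contains
      \<open>r\<close>, whose root is \<open>r\<close>, so that component is
      \<open>H\<close>.\<close>
    have "H' = H" if sub: "subgraph H H'" "subgraph H' (fgraph N f)" "Digraph_Component.connected H'" for H'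
    proof -
      obtain s where s: "f s = s" "subgraph H' (component f s)"
        using connected_subgraph_component[OF f sub(3,2)] by blast
      have "r \<in> verts H" using r root_ofI[of f r r] by (simp add: component_def)
      then have "r \<in> verts (component f s)" using sub(1) s(2) by (auto simp: subgraph_def)
      then have "s = r" using root_ofI[of f r r] r by (simp add: component_def)
      then show ?thesis using subgraph_antisym sub(1) s(2) r(3) by blast
    qed
    then show "H \<in> weak_components (fgraph N f)"
      using component_subgraph[OF f r(1)] component_connected[OF f r(2)] r(3)
      unfolding weak_components_def pre_digraph.max_subgraph_def by blast
  qed
qed

lemma card_weak_components_fgraph:
  assumes f: "forest_fun N f"
  shows "card (weak_components (fgraph N f)) = card (N \<inter> fixes_of f)"
proof -
  have "inj_on (component f) (N \<inter> fixes_of f)"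
  proof (rule inj_onI)
    fix r s assume *: "r \<in> N \<inter> fixes_of f" "s \<in> N \<inter> fixes_of f" "component f r = component f s"
    then have "{x. root_of f x = r} = {x. root_of f x = s}"
      by (metis component_def fgraph_simps(1))
    moreover have "root_of f r = r" using *(1) root_ofI[of f r r] by (simp add: fixes_of_def)
    ultimately show "r = s" by auto
  qed
  then show ?thesis by (simp add: weak_components_fgraph[OF f] card_image)
qed

text \<open>Indexing arcs by their tails, with value 0 at roots, allows weights to be compared
  vertex by vertex in exchanges.\<close>

lemma arc_weight_fgraph:
  assumes "finite N"
  shows "arc_weight v (fgraph N f) = (\<Sum>x\<in>N. if f x = x then 0 else v (x, f x))"
proof -
  have "arcs (fgraph N f) = (\<lambda>x. (x, f x)) ` {x \<in> N. f x \<noteq> x}" by auto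
  then have "arc_weight v (fgraph N f) = (\<Sum>x | x \<in> N \<and> f x \<noteq> x. v (x, f x))"
    unfolding arc_weight_def by (simp only:) (subst sum.reindex, auto simp: inj_on_def)
  also have "\<dots> = (\<Sum>x\<in>N. if f x = x then 0 else v (x, f x))"
    using assms by (intro sum.mono_neutral_cong_left) auto
  finally show ?thesis .
qed

lemma spanning_forests_iff:
  assumes V: "pair_wf_digraph V" and N: "finite (pverts V)"
  shows "F \<in> spanning_forests (with_proj V) k \<longleftrightarrow>
    (\<exists>f. forest_fun (pverts V) f \<and> (\<forall>x. f x \<noteq> x \<longrightarrow> (x, f x) \<in> parcs V)
      \<and> card (pverts V \<inter> fixes_of f) = k \<and> F = fgraph (pverts V) f)" (is "?L \<longleftrightarrow> ?R")
proof
  assume ?L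
  then have F: "in_forest F" "card (weak_components F) = k" "Digraph_Component.spanning F (with_proj V)"
    by (auto simp: spanning_forests_def)
  then have ends: "tail F = fst" "head F = snd" and v: "verts F = pverts V" and a: "arcs F \<subseteq> parcs V"
    by (auto simp: spanning_def subgraph_def compatible_def)
  obtain f where f: "forest_fun (pverts V) f" "F = fgraph (pverts V) f"
    using in_forest_eq_fgraph[OF F(1) ends] v by metis
  have "(x, f x) \<in> parcs V" if "f x \<noteq> x" for x
    using a that forest_funD(1)[OF f(1), of x] f(2) by auto
  then show ?R using f F(2) card_weak_components_fgraph[OF f(1)] by auto
next
  assume ?R
  then obtain f where f: "forest_fun (pverts V) f" "\<And>x. f x \<noteq> x \<Longrightarrow> (x, f x) \<in> parcs V"
    "card (pverts V \<inter> fixes_of f) = k" "F = fgraph (pverts V) f" by blast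
  have "wf_digraph (fgraph (pverts V) f)" by (rule wf_fgraph) (rule forest_funD(2)[OF f(1)])
  moreover have "wf_digraph (with_proj V)" using V
    by (auto simp: wf_digraph_def pair_wf_digraph_def)
  ultimately have "Digraph_Component.spanning F (with_proj V)"
    using f(2,4) by (auto simp: spanning_def subgraph_def compatible_def)
  then show ?L using f in_forest_fgraph[OF f(1) N] card_weak_components_fgraph[OF f(1)]
    by (simp add: spanning_forests_def)
qed

text \<open>Turning each vertex whose arc leaves \<open>E\<close> into a root gives a parent map of
  the induced graph. By \<open>exit\<close> it has at most one root in \<open>E\<close>, and it has
  one because \<open>E\<close> is nonempty.\<close>

lemma in_tree_induce:
  assumes f: "forest_fun N f" and N: "finite N" and E: "E \<subseteq> N" "E \<noteq> {}"
    and exit: "\<And>x y. x \<in> E \<Longrightarrow> y \<in> E \<Longrightarrow> f x = x \<or> f x \<notin> E \<Longrightarrow> f y = y \<or> f y \<notin> E \<Longrightarrow> x = y"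
  shows "in_tree (induce_subgraph (fgraph N f) E)"
proof -
  define A where "A = {x \<in> E. f x \<in> E}"
  define f' where "f' = mix f id A"
  have "z = x" if "reach id x z" for x z :: 'a using reach_fixed[OF that] by simp
  then have "forest_fun N f'" unfolding f'_def
    by (intro mix_forest[OF f]) (auto simp: forest_fun_def)
  then have f': "forest_fun E f'"
    by (auto simp: forest_fun_def f'_def mix_def A_def)
  have "induce_subgraph (fgraph N f) E = fgraph E f'"
    using E by (auto simp: induce_subgraph_def fgraph_def f'_def mix_def A_def)
  moreover have "card (E \<inter> fixes_of f') = 1"
  proof -
    obtain x where x: "x \<in> E" using E by blast
    let ?r = "root_of f' x"
    have r: "f' ?r = ?r" "?r \<in> E" using root_of[OF f', of x] reach_in_N[OF f'] x by auto
    moreover have "f y = y \<or> f y \<notin> E" if "y \<in> E" "f' y = y" for y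
      using that by (auto simp: f'_def mix_def A_def split: if_splits)
    ultimately have "E \<inter> fixes_of f' = {?r}" using exit by (auto simp: fixes_of_def)
    then show ?thesis by simp
  qed
  ultimately show ?thesis
    using in_forest_fgraph[OF f'] card_weak_components_fgraph[OF f'] finite_subset[OF E(1) N]
    by (simp add: in_tree_def)
qed

section \<open>Elementary sets\<close>

lemma algebra_generated_algebra:
  assumes "\<G> \<subseteq> Pow \<Omega>"
  shows "algebra \<Omega> (generated_algebra \<Omega> \<G>)"
  unfolding algebra_iff_Un
proof (intro conjI ballI)
  show "generated_algebra \<Omega> \<G> \<subseteq> Pow \<Omega>"
    unfolding generated_algebra_def by (rule Inter_lower) (use assms algebra_Pow in simp)
qed (auto simp: generated_algebra_def algebra_iff_Un)

lemma generator_in_generated_algebra: "S \<in> \<G> \<Longrightarrow> S \<in> generated_algebra \<Omega> \<G>"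
  by (auto simp: generated_algebra_def)

text \<open>\<open>E \<inter> S\<close> is a nonempty member of the algebra inside \<open>E\<close>,
  so minimality makes it all of \<open>E\<close>.\<close>

lemma elementary_set_inseparable:
  assumes "\<G> \<subseteq> Pow \<Omega>" and E: "E \<in> elementary_sets (generated_algebra \<Omega> \<G>)"
    and S: "S \<in> \<G>" and xy: "x \<in> E" "y \<in> E" "x \<in> S"
  shows "y \<in> S"
proof -
  interpret algebra \<Omega> "generated_algebra \<Omega> \<G>" by (rule algebra_generated_algebra[OF assms(1)])
  have "E \<inter> S \<in> generated_algebra \<Omega> \<G>"
    using E generator_in_generated_algebra[OF S] by (auto simp: elementary_sets_def)
  moreover have "\<forall>B\<in>generated_algebra \<Omega> \<G>. B \<noteq> {} \<and> B \<subseteq> E \<longrightarrow> B = E"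
    using E by (simp add: elementary_sets_def)
  moreover have "E \<inter> S \<noteq> {}" "E \<inter> S \<subseteq> E" using xy by auto
  ultimately have "E \<inter> S = E" by simp
  then show ?thesis using xy by blast
qed

text \<open>The sets that do not separate \<open>x\<close> from \<open>z\<close> form an algebra. If
  it contained every generator, it would contain \<open>E\<close>.\<close>

lemma generated_algebra_respects:
  assumes \<G>: "\<G> \<subseteq> Pow \<Omega>" and E: "E \<in> generated_algebra \<Omega> \<G>"
    and xz: "x \<in> \<Omega>" "z \<in> \<Omega>" "x \<in> E" "z \<notin> E"
  obtains S where "S \<in> \<G>" "x \<in> S \<longleftrightarrow> z \<notin> S"
proof -
  have "\<exists>S\<in>\<G>. x \<in> S \<longleftrightarrow> z \<notin> S"
  proof (rule ccontr)
    assume no: "\<not> ?thesis"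
    let ?M = "{S. S \<subseteq> \<Omega> \<and> (x \<in> S \<longleftrightarrow> z \<in> S)}"
    have "algebra \<Omega> ?M" using xz unfolding algebra_iff_Un by auto
    moreover have "\<G> \<subseteq> ?M" using \<G> no by blast
    moreover have "E \<in> M" if "algebra \<Omega> M" "\<G> \<subseteq> M" for M
      using E that by (simp add: generated_algebra_def)
    ultimately have "E \<in> ?M" by (metis (lifting))
    then show False using xz by simp
  qed
  then show ?thesis using that by blast
qed

text \<open>Stated additively to avoid truncated subtraction.\<close>

lemma card_fixes_mix:
  assumes "finite N" "A \<subseteq> N"
  shows "card (N \<inter> fixes_of (mix f g A)) + card (A \<inter> fixes_of g) = card (N \<inter> fixes_of g) + card (A \<inter> fixes_of f)"
proof -
  have fin: "finite A" "finite (N - A)" using assms finite_subset by auto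
  have split: "N \<inter> fixes_of (mix f g A) = (A \<inter> fixes_of f) \<union> ((N - A) \<inter> fixes_of g)"
    "N \<inter> fixes_of g = (A \<inter> fixes_of g) \<union> ((N - A) \<inter> fixes_of g)"
    using assms(2) by (auto simp: fixes_of_def mix_def)
  have card: "card (A \<inter> fixes_of h \<union> (N - A) \<inter> fixes_of g)
      = card (A \<inter> fixes_of h) + card ((N - A) \<inter> fixes_of g)" for h
    using fin by (intro card_Un_disjoint) auto
  have "card (N \<inter> fixes_of (mix f g A)) = card (A \<inter> fixes_of f) + card ((N - A) \<inter> fixes_of g)"
    unfolding split(1) by (rule card)
  moreover have "card (N \<inter> fixes_of g) = card (A \<inter> fixes_of g) + card ((N - A) \<inter> fixes_of g)"
    by (subst split(2)) (rule card)
  ultimately show ?thesis by simp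
qed

text \<open>At each vertex the two mixtures take the values of \<open>f\<close> and \<open>g\<close>
  in one order or the other.\<close>

lemma sum_mix_mix:
  fixes c :: "'a \<Rightarrow> 'a \<Rightarrow> real"
  shows "(\<Sum>x\<in>N. c x (mix f g A x)) + (\<Sum>x\<in>N. c x (mix g f A x)) = (\<Sum>x\<in>N. c x (f x)) + (\<Sum>x\<in>N. c x (g x))"
  unfolding sum.distrib[symmetric] by (intro sum.cong) (auto simp: mix_def)

section \<open>Minimal forests of \<open>V\<close> as an exchange family of parent maps\<close>

theorem theorem5:
  fixes V :: "nat pair_pre_digraph"
    and v :: "nat \<times> nat \<Rightarrow> real"
    and N k :: nat
  assumes "pair_wf_digraph V"
    and "pverts V = {1..N}"
    and "2 \<le> k" and "k \<le> N - 1"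
    and "spanning_forests (with_proj V) k \<noteq> {}"
    and "min_forest_weight (with_proj V) v (k - 1) - min_forest_weight (with_proj V) v k
         > min_forest_weight (with_proj V) v k - min_forest_weight (with_proj V) v (k + 1)"
  shows "\<forall>E \<in> elementary_sets (forest_algebra (with_proj V) v k).
         \<forall>F \<in> min_forests (with_proj V) v k. in_tree (induce_subgraph F E)"
proof (intro ballI)
  fix E F
  assume E: "E \<in> elementary_sets (forest_algebra (with_proj V) v k)"
    and F: "F \<in> min_forests (with_proj V) v k"
  define P where "P = pverts V"
  have finP: "finite P" using assms(2) by (simp add: P_def)
  define c where "c x y = (if y = x then 0 else v (x, y))" for x y
  define W where "W f = (\<Sum>x\<in>P. c x (f x))" for f
  have W: "arc_weight v (fgraph P f) = W f" for f
    unfolding W_def c_def by (rule arc_weight_fgraph[OF finP])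
  let ?\<phi> = "min_forest_weight (with_proj V) v"
  \<comment> \<open>The minimum is attained by \<open>F\<close>, hence is a real number.\<close>
  obtain w where w: "?\<phi> k = ereal w" using F unfolding min_forests_def by (metis (mono_tags) mem_Collect_eq)
  define adm where "adm f \<longleftrightarrow> forest_fun P f \<and> (\<forall>x. f x \<noteq> x \<longrightarrow> (x, f x) \<in> parcs V)" for f
  note sf = spanning_forests_iff[OF assms(1) finP[unfolded P_def], folded P_def]
  have low: "?\<phi> j \<le> ereal (W f)" if "adm f" "card (P \<inter> fixes_of f) = j" for f j
  proof -
    have "fgraph P f \<in> spanning_forests (with_proj V) j" using that sf by (auto simp: adm_def)
    then have "?\<phi> j \<le> ereal (arc_weight v (fgraph P f))"
      unfolding min_forest_weight_def by (rule INF_lower)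
    then show ?thesis by (simp add: W)
  qed
  define M where "M = {f. adm f \<and> card (P \<inter> fixes_of f) = k \<and> W f = w}"
  have M: "G \<in> min_forests (with_proj V) v k \<longleftrightarrow> (\<exists>f\<in>M. G = fgraph P f)" for G
    using sf w W unfolding min_forests_def M_def adm_def by auto
  interpret exchange_family P M k
  proof
    fix f g A assume fg: "f \<in> M" "g \<in> M" and A: "A \<subseteq> P"
      and fo: "forest_fun P (mix f g A)" "forest_fun P (mix g f A)"
    have adm: "adm (mix f g A)" "adm (mix g f A)" using fg fo by (auto simp: M_def adm_def mix_def)
    have sum: "W (mix f g A) + W (mix g f A) = 2 * w"
      using fg sum_mix_mix[of c f g A P] by (simp add: W_def M_def)
    have c1: "card (P \<inter> fixes_of (mix f g A)) + card (A \<inter> fixes_of g) = k + card (A \<inter> fixes_of f)"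
      using card_fixes_mix[OF finP A, of f g] fg by (simp add: M_def)
    have c2: "card (P \<inter> fixes_of (mix g f A)) + card (A \<inter> fixes_of f) = k + card (A \<inter> fixes_of g)"
      using card_fixes_mix[OF finP A, of g f] fg by (simp add: M_def)
    show "mix f g A \<in> M" if "card (A \<inter> fixes_of f) = card (A \<inter> fixes_of g)"
    proof -
      \<comment> \<open>Two weights that are at least \<open>w\<close> and add up to
        \<open>2 * w\<close> both equal \<open>w\<close>.\<close>
      have "w \<le> W (mix f g A)" "w \<le> W (mix g f A)"
        using low[OF adm(1), of k] low[OF adm(2), of k] c1 c2 that w by auto
      then show ?thesis using sum adm c1 that by (simp add: M_def)
    qed
    show "card (A \<inter> fixes_of g) \<noteq> card (A \<inter> fixes_of f) + 1"
    proof
      assume "card (A \<inter> fixes_of g) = card (A \<inter> fixes_of f) + 1"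
      \<comment> \<open>The mixtures now have \<open>k - 1\<close> and \<open>k + 1\<close> roots.
        Their weights add up to \<open>2 * w\<close>, which yields the reverse of the assumed strict
        inequality.\<close>
      then have "?\<phi> (k - 1) \<le> ereal (W (mix f g A))" "?\<phi> (k + 1) \<le> ereal (W (mix g f A))"
        using low[OF adm(1), of "k - 1"] low[OF adm(2), of "k + 1"] c1 c2 by auto
      then have le: "?\<phi> (k - 1) - ?\<phi> k \<le> ereal (W (mix f g A)) - ?\<phi> k"
        "?\<phi> k - ereal (W (mix g f A)) \<le> ?\<phi> k - ?\<phi> (k + 1)"
        by (auto intro: ereal_minus_mono)
      have eq: "ereal (W (mix f g A)) - ?\<phi> k = ?\<phi> k - ereal (W (mix g f A))"
        using sum by (simp add: w)
      show False using order_trans[OF le(1)[unfolded eq] le(2)] assms(6) by (rule leD[THEN notE])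
    qed
  qed (auto simp: finP M_def adm_def)
  define \<G> where "\<G> = (\<Union>F \<in> min_forests (with_proj V) v k. verts ` weak_components F)"
  \<comment> \<open>Generators become fibres of \<open>root_of\<close>, so separating two vertices
    by a generator means giving them different roots in some minimal forest.\<close>
  have \<G>: "\<G> = {{x. root_of f x = r} | f r. f \<in> M \<and> r \<in> P \<and> f r = r}"
  proof -
    have "verts ` weak_components (fgraph P f) = {{x. root_of f x = r} | r. r \<in> P \<and> f r = r}"
      if "f \<in> M" for f
      unfolding weak_components_fgraph[OF forest_M[OF that]]
      by (auto simp: component_def fixes_of_def image_image)
    moreover have "min_forests (with_proj V) v k = fgraph P ` M" using M by blast
    ultimately show ?thesis unfolding \<G>_def by auto
  qed
  have rP: "root_of f x \<in> P \<longleftrightarrow> x \<in> P" if "f \<in> M" for f x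
    using reach_in_N[OF forest_M[OF that]] root_of(1)[OF forest_M[OF that]] by metis
  have \<G>P: "\<G> \<subseteq> Pow P" using rP by (auto simp: \<G>)
  have E': "E \<in> elementary_sets (generated_algebra P \<G>)"
    using E by (simp add: forest_algebra_def \<G>_def P_def)
  then have EA: "E \<in> generated_algebra P \<G>" "E \<noteq> {}" by (auto simp: elementary_sets_def)
  have EP: "E \<subseteq> P" using algebra_generated_algebra[OF \<G>P] EA(1) by (simp add: algebra_iff_Un subset_eq)
  have same: "root_of g x = root_of g y" if "x \<in> E" "y \<in> E" "g \<in> M" for x y g
  proof -
    have "{z. root_of g z = root_of g x} \<in> \<G>"
      using that EP rP[of g x] root_of(2)[OF forest_M, of g x] unfolding \<G> by blast
    from elementary_set_inseparable[OF \<G>P E' this that(1,2)] show ?thesis by simp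
  qed
  have sep: "\<exists>g\<in>M. root_of g x \<noteq> root_of g z" if "x \<in> E" "z \<in> P" "z \<notin> E" for x z
  proof -
    have "x \<in> P" using that(1) EP by blast
    from generated_algebra_respects[OF \<G>P EA(1) this that(2,1,3)]
    obtain S where "S \<in> \<G>" "x \<in> S \<longleftrightarrow> z \<notin> S" .
    then show ?thesis unfolding \<G> by auto
  qed
  obtain f where f: "f \<in> M" "F = fgraph P f" using F M by blast
  show "in_tree (induce_subgraph F E)"
    unfolding f(2)
  proof (rule in_tree_induce[OF forest_M[OF f(1)] finP EP EA(2)])
    show "x = y" if "x \<in> E" "y \<in> E" "f x = x \<or> f x \<notin> E" "f y = y \<or> f y \<notin> E" for x y
      using atom_single_exit[OF f(1) EP same sep that(1,3,2,4)] .
  qed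
qed

end
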